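(* Let $m \ge 3$, let $\bar N = 16(m-1)+1$, and let $\bar R_m$ be the rectangular grid graph of dimensions $(\bar N \times m)$. Then $$8m-7 \le \Gamma(\bar R_m) \le 8m-6.$$
   Context: For $a,b \in \mathbb{N}$, the rectangular grid of dimensions $(a \times b)$ is the graph with vertex set $\{(i,j) \in \mathbb{Z}^2 : 1 \le i \le a,\ 1 \le j \le b\}$ and $(i_1,j_1) \sim (i_2,j_2)$ iff $|i_1-i_2|+|j_1-j_2|=1$. For a finite simple graph $G$ and $k \in \mathbb{N}$, a $k$-complete coloring of $G$ is a map $c: V(G) \to [k]=\{1,\dots,k\}$ such that for every pair of distinct colors $i \ne j$ in $[k]$ there is an edge $\{u,v\}$ with $c(u)=i$ and $c(v)=j$ (adjacent vertices may receive the same color). $\Gamma(G)$, the complete coloring number, is the largest $k$ for which a $k$-complete coloring of $G$ exists. *)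

theory Defs
  imports "HOL-Library.FuncSet" "Graph_Theory.Pair_Digraph"
begin

text \<open>
  A finite simple graph is a symmetric, loop-free \<^typ>\<open>'a pair_pre_digraph\<close> on a finite vertex
  set (locale \<^locale>\<open>pair_graph\<close>): an edge $\{u,v\}$ is represented by the two arcs $(u,v)$ and
  $(v,u)$.
\<close>

definition grid_graph :: "nat \<Rightarrow> nat \<Rightarrow> (int \<times> int) pair_pre_digraph" where
  "grid_graph a b =
    \<lparr> pverts = {(i, j). 1 \<le> i \<and> i \<le> int a \<and> 1 \<le> j \<and> j \<le> int b},
      parcs = {((i\<^sub>1, j\<^sub>1), (i\<^sub>2, j\<^sub>2)).
        1 \<le> i\<^sub>1 \<and> i\<^sub>1 \<le> int a \<and> 1 \<le> j\<^sub>1 \<and> j\<^sub>1 \<le> int b \<and>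
        1 \<le> i\<^sub>2 \<and> i\<^sub>2 \<le> int a \<and> 1 \<le> j\<^sub>2 \<and> j\<^sub>2 \<le> int b \<and>
        \<bar>i\<^sub>1 - i\<^sub>2\<bar> + \<bar>j\<^sub>1 - j\<^sub>2\<bar> = 1} \<rparr>"

definition complete_coloring :: "'a pair_pre_digraph \<Rightarrow> nat \<Rightarrow> ('a \<Rightarrow> nat) \<Rightarrow> bool" where
  "complete_coloring G k c \<longleftrightarrow>
    c \<in> pverts G \<rightarrow> {1..k} \<and>
    (\<forall>i\<in>{1..k}. \<forall>j\<in>{1..k}. i \<noteq> j \<longrightarrow> (\<exists>u v. (u, v) \<in> parcs G \<and> c u = i \<and> c v = j))"

definition complete_coloring_number :: "'a pair_pre_digraph \<Rightarrow> nat" (\<open>\<Gamma>\<close>) where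
  "\<Gamma> G = Max {k. \<exists>c. complete_coloring G k c}"

lemma pair_graph_grid_graph: "pair_graph (grid_graph a b)"
proof -
  have eq: "pverts (grid_graph a b) = {1..int a} \<times> {1..int b}"
    by (auto simp: grid_graph_def)
  have fin: "finite (pverts (grid_graph a b))"
    by (simp add: eq)
  have sub: "parcs (grid_graph a b) \<subseteq> pverts (grid_graph a b) \<times> pverts (grid_graph a b)"
    by (auto simp: grid_graph_def)
  show ?thesis
  proof unfold_locales
    show "finite (parcs (grid_graph a b))"
      using finite_subset[OF sub] fin by simp
    show "symmetric (with_proj (grid_graph a b))"
      by (auto simp: symmetric_def grid_graph_def intro!: symI)
  qed (use fin in \<open>auto simp: grid_graph_def\<close>)
qed

text \<open>
  For a finite simple graph, the set of all \<open>k\<close> admitting a \<open>k\<close>-complete coloring is finite and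
  nonempty, so that \<^const>\<open>Max\<close> does select its largest element.
\<close>

lemma complete_coloring_le_card:
  assumes "pair_graph G" "complete_coloring G k c"
  shows "k \<le> card (pverts G) + 1"
proof (cases "k \<le> 1")
  case False
  interpret pair_graph G by fact
  have "{1..k} \<subseteq> c ` pverts G"
  proof
    fix i assume i: "i \<in> {1..k}"
    obtain j where "j \<in> {1..k}" "i \<noteq> j"
      using False by (cases "i = 1") (auto intro: that[of 1] that[of 2])
    with i assms(2) obtain u v where "(u, v) \<in> parcs G" "c u = i"
      unfolding complete_coloring_def by meson
    then show "i \<in> c ` pverts G" using in_arcsD1 by blast
  qed
  then have "card {1..k} \<le> card (pverts G)"
    using pair_finite_verts surj_card_le by blast
  then show ?thesis by simp
qed simp

lemma finite_complete_coloring: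
  assumes "pair_graph G"
  shows "finite {k. \<exists>c. complete_coloring G k c}"
  by (rule finite_subset[of _ "{..card (pverts G) + 1}"])
    (use complete_coloring_le_card[OF assms] in auto)

lemma ex_complete_coloring: "\<exists>k c. complete_coloring G k c"
  by (intro exI[of _ 1] exI[of _ "\<lambda>_. 1"]) (auto simp: complete_coloring_def)

end

theory Submission
  imports Defs
begin

text \<open>
  The upper bound counts edges. For the lower bound put \<open>t = m - 1\<close> and \<open>n = 8 * t\<close>, so that the
  grid has \<open>2 * n + 1\<close> rows and \<open>t + 1\<close> columns, and colour it with \<open>\<int>/n\<close> and one extra colour
  \<open>\<infinity>\<close>. Number rows and columns from 0; row \<open>2 * r\<close> of column \<open>j\<close> gets \<open>x j + r\<close> and row
  \<open>2 * r + 1\<close> gets \<open>y j + r\<close>. Going once around \<open>\<int>/n\<close>, each column then realises all pairs of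
  colours with difference \<open>y j - x j\<close> or \<open>y j - x j - 1\<close>, and two adjacent columns all pairs
  with difference \<open>x (j + 1) - x j\<close> or \<open>y (j + 1) - y j\<close>. The offsets are chosen such that column 0
  yields only the useless differences 0 and 1, that the odd rows of columns 0 and 1 differ by \<open>n / 2\<close>,
  whose pairs are realised twice, and that the rest yields each of
  \<open>1, \<dots>, n / 2 - 1\<close>. Therefore half of the odd entries of column 0 can be replaced with \<open>\<infinity>\<close>,
  and the neighbours of these entries happen to carry all colours of \<open>\<int>/n\<close>.
\<close>

section \<open>Upper bound: counting edges\<close>

text \<open>An edge is determined by its direction and its endpoint with the smaller coordinates,
  which lies in \<open>V\<close> or \<open>H\<close>; it gives two arcs.\<close>

lemma card_parcs_grid_graph:
  "card (parcs (grid_graph a b)) \<le> 2 * ((a - 1) * b + a * (b - 1))"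
proof -
  define V where "V = {1..int a - 1} \<times> {1..int b}"
  define H where "H = {1..int a} \<times> {1..int b - 1}"
  have "parcs (grid_graph a b) \<subseteq>
      ((\<lambda>(i, j). ((i, j), (i + 1, j))) ` V \<union> (\<lambda>(i, j). ((i + 1, j), (i, j))) ` V)
    \<union> ((\<lambda>(i, j). ((i, j), (i, j + 1))) ` H \<union> (\<lambda>(i, j). ((i, j + 1), (i, j))) ` H)"
    (is "_ \<subseteq> (?A \<union> ?B) \<union> (?C \<union> ?D)")
  proof
    fix e assume e: "e \<in> parcs (grid_graph a b)"
    obtain i j k l where ijkl: "e = ((i, j), (k, l))" by (metis surj_pair)
    consider "k = i + 1" "l = j" | "i = k + 1" "l = j" | "k = i" "l = j + 1" | "k = i" "j = l + 1"
      using e unfolding ijkl grid_graph_def by simp linarith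
    then show "e \<in> (?A \<union> ?B) \<union> (?C \<union> ?D)"
      using e unfolding ijkl grid_graph_def V_def H_def by cases (auto simp: image_iff)
  qed
  moreover have fin: "finite V" "finite H" by (auto simp: V_def H_def)
  ultimately have "card (parcs (grid_graph a b)) \<le> card ((?A \<union> ?B) \<union> (?C \<union> ?D))"
    by (intro card_mono) auto
  also have "\<dots> \<le> (card ?A + card ?B) + (card ?C + card ?D)"
    by (meson add_mono card_Un_le order_trans)
  also have "\<dots> \<le> (card V + card V) + (card H + card H)"
    by (intro add_mono card_image_le fin)
  also have "\<dots> = 2 * ((a - 1) * b + a * (b - 1))"
    by (simp add: V_def H_def card_cartesian_product nat_diff_distrib')
  finally show ?thesis .
qed

text \<open>Each arc realises only one ordered pair of colours.\<close>

lemma complete_coloring_le_arcs: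
  assumes "finite (parcs G)" "complete_coloring G k c"
  shows "k * (k - 1) \<le> card (parcs G)"
proof -
  let ?P = "{1..k} \<times> {1..k} - (\<lambda>i. (i, i)) ` {1..k}"
  have "?P \<subseteq> map_prod c c ` parcs G"
  proof
    fix p assume "p \<in> ?P"
    moreover obtain i j where "p = (i, j)" by fastforce
    ultimately have "p = (i, j)" "i \<in> {1..k}" "j \<in> {1..k}" "i \<noteq> j" by auto
    with assms(2) show "p \<in> map_prod c c ` parcs G"
      unfolding complete_coloring_def by (metis map_prod_imageI)
  qed
  then have "card ?P \<le> card (parcs G)"
    using assms(1) by (meson card_image_le card_mono finite_imageI order_trans)
  moreover have "card ?P = k * k - k"
    by (subst card_Diff_subset) (auto simp: card_cartesian_product card_image inj_on_def)
  ultimately show ?thesis by (simp add: algebra_simps)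
qed

section \<open>Complete colourings from differences modulo \<open>n\<close>\<close>

text \<open>With colours from 0 to \<open>n\<close>, residues modulo \<open>n\<close> are colours
  themselves and \<open>n\<close> is left for \<infinity>.\<close>

lemma complete_coloring_exI:
  assumes range: "\<And>u. u \<in> pverts G \<Longrightarrow> 0 \<le> f u \<and> f u \<le> n"
    and sym: "symmetric (with_proj G)"
    and pairs: "\<And>p q. 0 \<le> p \<Longrightarrow> p < q \<Longrightarrow> q \<le> n \<Longrightarrow> \<exists>(u, v) \<in> parcs G. f u = p \<and> f v = q"
  shows "\<exists>c. complete_coloring G (nat n + 1) c"
proof -
  have pairs': "\<exists>u v. (u, v) \<in> parcs G \<and> f u = p \<and> f v = q"
    if "0 \<le> p" "p \<le> n" "0 \<le> q" "q \<le> n" "p \<noteq> q" for p q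
  proof (cases "p < q")
    case True
    then show ?thesis using pairs[of p q] that by blast
  next
    case False
    then have "\<exists>(u, v) \<in> parcs G. f u = q \<and> f v = p"
      using pairs[of q p] that by simp
    then obtain u v where "(u, v) \<in> parcs G" "f u = q" "f v = p" by blast
    moreover from this have "(v, u) \<in> parcs G"
      using sym by (auto simp: symmetric_def sym_def)
    ultimately show ?thesis by blast
  qed
  have "complete_coloring G (nat n + 1) (\<lambda>u. nat (f u) + 1)"
    unfolding complete_coloring_def
  proof (intro conjI ballI impI)
    show "(\<lambda>u. nat (f u) + 1) \<in> pverts G \<rightarrow> {1..nat n + 1}"
      by (auto simp: range intro!: nat_mono)
  next
    fix i j :: nat assume ij: "i \<in> {1..nat n + 1}" "j \<in> {1..nat n + 1}" "i \<noteq> j"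
    then have "0 \<le> int i - 1" "int i - 1 \<le> n" "0 \<le> int j - 1" "int j - 1 \<le> n" by auto
    with ij(3) obtain u v where "(u, v) \<in> parcs G" "f u = int i - 1" "f v = int j - 1"
      using pairs'[of "int i - 1" "int j - 1"] by auto
    with ij show "\<exists>u v. (u, v) \<in> parcs G \<and> nat (f u) + 1 = i \<and> nat (f v) + 1 = j"
      by (intro exI[of _ u] exI[of _ v]) auto
  qed
  then show ?thesis by blast
qed

text \<open>
  In the notation of the header, \<open>h j = x (j + 1) - x j\<close> and \<open>a j = y j - x j\<close>; the prescribed
  values make \<open>y 1 - y 0 = 4 * t\<close>.
\<close>

lemma complete_coloring_of_differences:
  fixes t :: nat and a h :: "nat \<Rightarrow> int"
  assumes t: "t \<ge> 1" and a0: "a 0 = 1" and a1: "a 1 = 2" and h0: "h 0 = 4 * int t - 1"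
    and cover: "\<And>d. 1 \<le> d \<Longrightarrow> d < 4 * int t \<Longrightarrow>
      \<exists>e \<in> a ` {1..t} \<union> (\<lambda>j. a j - 1) ` {1..t} \<union> h ` {..<t} \<union> (\<lambda>j. h j + a (j + 1) - a j) ` {1..<t}.
        e mod (8 * int t) = d mod (8 * int t) \<or> e mod (8 * int t) = (- d) mod (8 * int t)"
  shows "\<exists>c. complete_coloring (grid_graph (16 * t + 1) (t + 1)) (8 * t + 1) c"
proof -
  define n where "n = 8 * int t"
  have n: "n > 0" using t by (simp add: n_def)
  define x where "x j = (\<Sum>i<j. h i)" for j
  define y where "y j = x j + a j" for j
  let ?G = "grid_graph (16 * t + 1) (t + 1)"
  \<comment> \<open>Coordinates start at 1, hence \<open>i - 1\<close> and \<open>j - 1\<close>. The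
    value \<open>n\<close> is \<infinity>; it fills the first half of the odd rows of column
    0.\<close>
  define f :: "int \<times> int \<Rightarrow> int" where
    "f = (\<lambda>(i, j). let r = (i - 1) div 2 in
       if even (i - 1) then (x (nat (j - 1)) + r) mod n
       else if j = 1 \<and> r < 4 * int t then n
       else (y (nat (j - 1)) + r) mod n)"
  have f_even: "f (2 * r + 1, int j + 1) = (x j + r) mod n" for r j
    by (simp add: f_def)
  have f_odd: "f (2 * r + 2, int j + 1) = (y j + r) mod n" if "j \<ge> 1 \<or> r \<ge> 4 * int t" for r j
  proof -
    have "(2 * r + 2 - 1) div 2 = r" "odd (2 * r + 2 - 1)" by presburger+
    then show ?thesis using that by (auto simp: f_def)
  qed
  have f_inf: "f (2 * r + 2, 1) = n" if "r < 4 * int t" for r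
  proof -
    have "(2 * r + 2 - 1) div 2 = r" "odd (2 * r + 2 - 1)" by presburger+
    then show ?thesis using that by (auto simp: f_def)
  qed
  define adj where "adj p q \<longleftrightarrow> (\<exists>(u, v) \<in> parcs ?G. f u = p \<and> f v = q)" for p q
  have sym: "symmetric (with_proj ?G)"
    using pair_graph_grid_graph[of "16 * t + 1" "t + 1"]
    by (auto simp: symmetric_def grid_graph_def intro!: symI)
  have adj_sym: "adj p q \<Longrightarrow> adj q p" for p q
    using sym unfolding adj_def symmetric_def sym_def by fastforce
  have vert: "adj (f (i, int j + 1)) (f (i + 1, int j + 1))" if "1 \<le> i" "i \<le> 2 * n" "j \<le> t" for i j
    unfolding adj_def using that
    by (intro bexI[of _ "((i, int j + 1), (i + 1, int j + 1))"]) (auto simp: grid_graph_def n_def)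
  have horiz: "adj (f (i, int j + 1)) (f (i, int (j + 1) + 1))"
    if "1 \<le> i" "i \<le> 2 * n + 1" "j < t" for i j
    unfolding adj_def using that
    by (intro bexI[of _ "((i, int j + 1), (i, int (j + 1) + 1))"]) (auto simp: grid_graph_def n_def)
  \<comment> \<open>\<open>r\<close> runs through a whole period, so every residue occurs as the
    first colour of a pair.\<close>
  have shift: "\<exists>r. 0 \<le> r \<and> r < n \<and> (z + r) mod n = p mod n" for z p
    using n by (intro exI[of _ "(p - z) mod n"]) (simp add: mod_add_right_eq)
  have shift_by: "(w + r) mod n = (p + (w - z)) mod n" if "(z + r) mod n = p mod n" for z w r p
  proof -
    have "(w + r) mod n = (z + r + (w - z)) mod n" by (simp add: algebra_simps)
    also have "\<dots> = (p + (w - z)) mod n" using that by (metis mod_add_left_eq)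
    finally show ?thesis .
  qed
  have adj_diff: "adj (p mod n) ((p + e) mod n)"
    if "e \<in> a ` {1..t} \<union> (\<lambda>j. a j - 1) ` {1..t} \<union> h ` {..<t} \<union> (\<lambda>j. h j + a (j + 1) - a j) ` {1..<t}"
    for e p
  proof -
    from that consider j where "j \<in> {1..t}" "e = a j" | j where "j \<in> {1..t}" "e = a j - 1"
      | j where "j < t" "e = h j" | j where "j \<in> {1..<t}" "e = h j + a (j + 1) - a j" by auto
    then show ?thesis
    proof cases
      case 1
      obtain r where r: "0 \<le> r" "r < n" "(x j + r) mod n = p mod n" using shift by blast
      have "adj (f (2 * r + 1, int j + 1)) (f (2 * r + 2, int j + 1))"
        using vert[of "2 * r + 1" j] r 1 by (simp add: add.assoc)
      then show ?thesis
        using r(3) shift_by[OF r(3), of "y j"] 1 by (simp add: f_even f_odd y_def)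
    next
      case 2
      \<comment> \<open>The entry after row \<open>2 * r + 1\<close> has colour
        \<open>x j + 1 + r\<close>; for \<open>r = n - 1\<close> it lies in the additional last
        row.\<close>
      obtain r where r: "0 \<le> r" "r < n" "(x j + 1 + r) mod n = p mod n" using shift by blast
      have "adj (f (2 * r + 2, int j + 1)) (f (2 * (r + 1) + 1, int j + 1))"
        using vert[of "2 * r + 2" j] r 2 by (simp add: add.assoc)
      then have "adj (f (2 * (r + 1) + 1, int j + 1)) (f (2 * r + 2, int j + 1))"
        by (rule adj_sym)
      moreover have "f (2 * (r + 1) + 1, int j + 1) = p mod n"
        unfolding f_even using r(3) by (simp add: ac_simps)
      moreover have "y j - (x j + 1) = e" using 2 by (simp add: y_def)
      moreover have "f (2 * r + 2, int j + 1) = (y j + r) mod n"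
        using f_odd[of j r] 2 by simp
      ultimately show ?thesis
        using shift_by[OF r(3), of "y j"] by simp
    next
      case 3
      obtain r where r: "0 \<le> r" "r < n" "(x j + r) mod n = p mod n" using shift by blast
      have "adj (f (2 * r + 1, int j + 1)) (f (2 * r + 1, int (j + 1) + 1))"
        using horiz[of "2 * r + 1" j] r 3 by simp
      then show ?thesis
        unfolding f_even using r(3) shift_by[OF r(3), of "x (j + 1)"] 3 by (simp add: x_def)
    next
      case 4
      obtain r where r: "0 \<le> r" "r < n" "(y j + r) mod n = p mod n" using shift by blast
      have "adj (f (2 * r + 2, int j + 1)) (f (2 * r + 2, int (j + 1) + 1))"
        using horiz[of "2 * r + 2" j] r 4 by simp
      moreover have "y (j + 1) - y j = e" using 4 by (simp add: x_def y_def)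
      moreover have "f (2 * r + 2, int j + 1) = p mod n"
        using f_odd[of j r] 4 r(3) by simp
      moreover have "f (2 * r + 2, int (j + 1) + 1) = (y (j + 1) + r) mod n"
        by (rule f_odd) simp
      ultimately show ?thesis
        using shift_by[OF r(3), of "y (j + 1)"] by simp
    qed
  qed
  have adj_small: "adj (p mod n) ((p + d) mod n)" if d: "1 \<le> d" "d < 4 * int t" for p d
  proof -
    obtain e where e: "e \<in> a ` {1..t} \<union> (\<lambda>j. a j - 1) ` {1..t} \<union> h ` {..<t} \<union>
        (\<lambda>j. h j + a (j + 1) - a j) ` {1..<t}" "e mod n = d mod n \<or> e mod n = (- d) mod n"
      using cover[OF d] unfolding n_def by blast
    from e(2) show ?thesis
    proof
      assume "e mod n = d mod n"
      then have "(p + e) mod n = (p + d) mod n" by (metis mod_add_right_eq)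
      with adj_diff[OF e(1), of p] show ?thesis by simp
    next
      assume "e mod n = (- d) mod n"
      then have "(p + d + e) mod n = (p + d + - d) mod n" by (metis mod_add_right_eq)
      with adj_diff[OF e(1), of "p + d"] show ?thesis by (simp add: adj_sym)
    qed
  qed
  have x01: "x 0 = 0" "x 1 = 4 * int t - 1" "y 0 = 1" "y 1 = 4 * int t + 1"
    using a0 a1 h0 by (simp_all add: x_def y_def)
  \<comment> \<open>Replacing \<open>r\<close> by \<open>r + n / 2\<close> only swaps the two
    colours, so the half \<open>r \<ge> 4 * t\<close>, free of \<infinity>, suffices. There
    \<open>p = 0\<close> occurs at \<open>r = n - 1\<close>, any other \<open>p\<close> at
    \<open>r = p + 4 * t - 1\<close> in reversed order.\<close>
  have adj_half: "adj p (p + 4 * int t)" if p: "0 \<le> p" "p < 4 * int t" for p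
  proof -
    have "adj ((1 + r) mod n) ((4 * int t + 1 + r) mod n)" if r: "4 * int t \<le> r" "r < n" for r
    proof -
      have "adj (f (2 * r + 2, int 0 + 1)) (f (2 * r + 2, int (0 + 1) + 1))"
        using horiz[of "2 * r + 2" 0] r t by simp
      moreover have "f (2 * r + 2, int 0 + 1) = (y 0 + r) mod n"
        by (rule f_odd) (use r in simp)
      moreover have "f (2 * r + 2, int (0 + 1) + 1) = (y 1 + r) mod n"
        using f_odd[of 1 r] by simp
      ultimately show ?thesis using x01 by simp
    qed
    note * = this
    show ?thesis
    proof (cases "p = 0")
      case True
      have "(4 * int t + 1 + (n - 1)) mod n = 4 * int t"
        using t by (simp add: n_def)
      then show ?thesis using *[of "n - 1"] True n t by (simp add: n_def mult.commute)
    next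
      case False
      have "(4 * int t + 1 + (p + 4 * int t - 1)) mod n = (p + n) mod n" by (simp add: n_def)
      also have "\<dots> = p" using p by (simp add: n_def)
      finally have "adj (p + 4 * int t) p"
        using *[of "p + 4 * int t - 1"] False p by (simp add: n_def)
      then show ?thesis by (rule adj_sym)
    qed
  qed
  \<comment> \<open>The \<infinity> in row \<open>2 * r + 1\<close> has vertical neighbours
    \<open>r\<close> and \<open>r + 1\<close>, which cover 0 to \<open>4 * t\<close>, and the
    horizontal neighbour \<open>4 * t + 1 + r\<close>, which covers the rest.\<close>
  have adj_inf: "adj p n" if p: "0 \<le> p" "p < n" for p
  proof -
    consider "p = 0" | "1 \<le> p" "p \<le> 4 * int t" | "p > 4 * int t" using p by linarith
    then show ?thesis
    proof cases
      case 1
      have "adj (f (1, int 0 + 1)) (f (2, int 0 + 1))"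
        using vert[of 1 0] n by simp
      then show ?thesis
        using f_even[of 0 0] f_inf[of 0] x01 1 t by simp
    next
      case 2
      have "adj (f (2 * (p - 1) + 2, int 0 + 1)) (f (2 * p + 1, int 0 + 1))"
        using vert[of "2 * p" 0] 2 p by simp
      then have "adj n p"
        using f_even[of p 0] f_inf[of "p - 1"] x01 2 p by simp
      then show ?thesis by (rule adj_sym)
    next
      case 3
      define r where "r = p - 4 * int t - 1"
      have r: "0 \<le> r" "r < 4 * int t" "y 1 + r = p" using 3 p x01 by (auto simp: r_def n_def)
      have "adj (f (2 * r + 2, int 0 + 1)) (f (2 * r + 2, int (0 + 1) + 1))"
        using horiz[of "2 * r + 2" 0] r t by (simp add: n_def)
      then have "adj n p"
        using f_odd[of 1 r] f_inf[of r] r p by simp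
      then show ?thesis by (rule adj_sym)
    qed
  qed
  have "\<exists>c. complete_coloring ?G (nat n + 1) c"
  proof (rule complete_coloring_exI[where f = f])
    fix u
    have "0 \<le> z mod n \<and> z mod n \<le> n" for z
      using n by (simp add: order_less_imp_le)
    then show "0 \<le> f u \<and> f u \<le> n"
      using n by (auto simp: f_def Let_def split: prod.split)
  next
    show "symmetric (with_proj ?G)" by (fact sym)
  next
    fix p q assume pq: "0 \<le> p" "p < q" "q \<le> n"
    consider "q = n" | "q < n" "q - p < 4 * int t" | "q < n" "q - p = 4 * int t"
      | "q < n" "q - p > 4 * int t" using pq by linarith
    then have "adj p q"
    proof cases
      case 1
      then show ?thesis using adj_inf[of p] pq by simp
    next
      case 2
      then show ?thesis using adj_small[of "q - p" p] pq by simp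
    next
      case 3
      then show ?thesis using adj_half[of p] pq by (simp add: n_def algebra_simps)
    next
      case 4
      \<comment> \<open>Going round the other way gives a difference below
        \<open>n / 2\<close>.\<close>
      have "(q + (p + n - q)) mod n = p" using pq 4 by simp
      then have "adj q p" using adj_small[of "p + n - q" q] pq 4 by (simp add: n_def)
      then show ?thesis by (rule adj_sym)
    qed
    then show "\<exists>(u, v) \<in> parcs ?G. f u = p \<and> f v = q" unfolding adj_def .
  qed
  then show ?thesis by (simp add: n_def nat_mult_distrib)
qed

section \<open>Choice of the offsets\<close>

text \<open>
  The columns \<open>j \<ge> 1\<close> yield the differences \<open>2 * j - 1\<close> and \<open>2 * j\<close>, and \<open>h 0\<close> yields
  \<open>4 * t - 1\<close>. Since \<open>a\<close> has steps of \<open>\<plusminus> 2\<close>, the remaining \<open>2 * t - 2\<close> differences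
  have to be grouped into pairs \<open>{u, u + 2}\<close>, which works blockwise if \<open>4\<close> divides their number, that is, for
  odd \<open>t\<close>. For even \<open>t\<close> a change of sign after \<open>a 1\<close> produces one step of \<open>- 5\<close>, and
  \<open>- (4 * t - 3) - 5 \<equiv> 4 * t - 2\<close> modulo \<open>8 * t\<close> disposes of the two largest differences.
\<close>

lemma complete_coloring_grid:
  assumes t: "t \<ge> 2"
  shows "\<exists>c. complete_coloring (grid_graph (16 * t + 1) (t + 1)) (8 * t + 1) c"
proof (cases "odd t")
  case True
  define a where "a j = (if j = 0 then 1 else 2 * int j)" for j :: nat
  define h where "h j = (if j = 0 then 4 * int t - 1 else
    if odd j then 2 * int t + 2 * int j - 1 else 2 * int t + 2 * int j - 2)" for j :: nat
  show ?thesis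
  proof (rule complete_coloring_of_differences[where a = a and h = h])
    fix d :: int assume d: "1 \<le> d" "d < 4 * int t"
    let ?S = "a ` {1..t} \<union> (\<lambda>j. a j - 1) ` {1..t} \<union> h ` {..<t} \<union>
      (\<lambda>j. h j + a (j + 1) - a j) ` {1..<t}"
    have "d \<in> ?S"
    proof (cases "d \<le> 2 * int t")
      case True
      define j where "j = nat ((d + 1) div 2)"
      have j: "j \<in> {1..t}" using True d unfolding j_def by auto
      have "d = a j \<or> d = a j - 1" using j d unfolding a_def j_def by auto
      with j show ?thesis by blast
    next
      case large: False
      show ?thesis
      proof (cases "d = 4 * int t - 1")
        case True
        then have "d = h 0" by (simp add: h_def)
        moreover have "0 \<in> {..<t}" using t by simp
        ultimately show ?thesis by blast
      next
        case False
        \<comment> \<open>Block \<open>q\<close> is \<open>u, \<dots>, u + 3\<close> with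
          \<open>u = 2 * t + 1 + 4 * q\<close>: \<open>j = 2 * q + 1\<close> yields \<open>u\<close>
          and \<open>u + 2\<close>, the next \<open>j\<close> yields \<open>u + 1\<close> and
          \<open>u + 3\<close>.\<close>
        define q where "q = nat ((d - 2 * int t - 1) div 4)"
        obtain s where s: "t = 2 * s + 1" using \<open>odd t\<close> by (rule oddE)
        have "0 \<le> (d - 2 * int t - 1) div 4" "(d - 2 * int t - 1) div 4 < int s"
          using False large d unfolding s by auto
        then have q: "2 * q + 2 < t" unfolding q_def s by linarith
        have "int q = (d - 2 * int t - 1) div 4" using large unfolding q_def by simp
        then consider "d = 2 * int t + 1 + 4 * int q" | "d = 2 * int t + 2 + 4 * int q"
          | "d = 2 * int t + 3 + 4 * int q" | "d = 2 * int t + 4 + 4 * int q"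
          by atomize_elim presburger
        then have "d \<in> h ` {2 * q + 1, 2 * q + 2} \<union>
            (\<lambda>j. h j + a (j + 1) - a j) ` {2 * q + 1, 2 * q + 2}"
          by cases (simp_all add: h_def a_def)
        with q show ?thesis by auto
      qed
    qed
    then show "\<exists>e\<in>?S. e mod (8 * int t) = d mod (8 * int t) \<or> e mod (8 * int t) = (- d) mod (8 * int t)"
      by blast
  qed (use t in \<open>simp_all add: a_def h_def\<close>)
next
  case False
  define a where "a j = (if j = 0 then 1 else if j = 1 then 2 else 1 - 2 * int j)" for j :: nat
  define h where "h j = (if j = 0 then 4 * int t - 1 else if j = 1 then 3 - 4 * int t else
    if even j then 2 * int t + 2 * int j - 1 else 2 * int t + 2 * int j - 2)" for j :: nat
  show ?thesis
  proof (rule complete_coloring_of_differences[where a = a and h = h])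
    fix d :: int assume d: "1 \<le> d" "d < 4 * int t"
    let ?S = "a ` {1..t} \<union> (\<lambda>j. a j - 1) ` {1..t} \<union> h ` {..<t} \<union>
      (\<lambda>j. h j + a (j + 1) - a j) ` {1..<t}"
    consider "d \<le> 2" | "3 \<le> d" "d \<le> 2 * int t" | "d = 4 * int t - 1" | "d = 4 * int t - 2"
      | "d = 4 * int t - 3" | "2 * int t < d" "d \<le> 4 * int t - 4"
      using d by linarith
    then have "d \<in> ?S \<or> - d \<in> ?S \<or> d - 8 * int t \<in> ?S"
    proof cases
      case 1
      then have "d = a 1 \<or> d = a 1 - 1" using d by (auto simp: a_def)
      moreover have "1 \<in> {1..t}" using t by simp
      ultimately show ?thesis by blast
    next
      case 2
      define j where "j = nat ((d + 1) div 2)"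
      have j: "j \<in> {1..t}" "j \<ge> 2" using 2 unfolding j_def by auto
      then have "- d = a j \<or> - d = a j - 1" using d unfolding a_def j_def by auto
      with j show ?thesis by blast
    next
      case 3
      then have "d = h 0" by (simp add: h_def)
      moreover have "0 \<in> {..<t}" using t by simp
      ultimately show ?thesis by blast
    next
      case 4
      then have "d - 8 * int t = h 1 + a (1 + 1) - a 1" by (simp add: h_def a_def)
      moreover have "1 \<in> {1..<t}" using t by simp
      ultimately show ?thesis by blast
    next
      case 5
      then have "- d = h 1" by (simp add: h_def)
      moreover have "1 \<in> {..<t}" using t by simp
      ultimately show ?thesis by blast
    next
      case 6
      \<comment> \<open>The same blocks, with \<open>j\<close> one larger because
        \<open>j = 1\<close> serves the sign change; \<open>a\<close> now falls by 2, so
        \<open>h j\<close> is the larger of its two differences.\<close>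
      define q where "q = nat ((d - 2 * int t - 1) div 4)"
      obtain s where s: "t = 2 * s" using False by auto
      have "0 \<le> (d - 2 * int t - 1) div 4" "(d - 2 * int t - 1) div 4 < int s - 1"
        using 6 unfolding s by auto
      then have q: "2 * q + 3 < t" unfolding q_def s by linarith
      have "int q = (d - 2 * int t - 1) div 4" using 6 unfolding q_def by simp
      then consider "d = 2 * int t + 1 + 4 * int q" | "d = 2 * int t + 2 + 4 * int q"
        | "d = 2 * int t + 3 + 4 * int q" | "d = 2 * int t + 4 + 4 * int q"
        by atomize_elim presburger
      then have "d \<in> h ` {2 * q + 2, 2 * q + 3} \<union>
          (\<lambda>j. h j + a (j + 1) - a j) ` {2 * q + 2, 2 * q + 3}"
        by cases (simp_all add: h_def a_def)
      moreover have "{2 * q + 2, 2 * q + 3} \<subseteq> {..<t}" "{2 * q + 2, 2 * q + 3} \<subseteq> {1..<t}"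
        using q by auto
      ultimately show ?thesis by blast
    qed
    moreover have "(d - 8 * int t) mod (8 * int t) = d mod (8 * int t)" by simp
    ultimately show
      "\<exists>e\<in>?S. e mod (8 * int t) = d mod (8 * int t) \<or> e mod (8 * int t) = (- d) mod (8 * int t)"
      by blast
  qed (use t in \<open>simp_all add: a_def h_def\<close>)
qed

theorem theorem5:
  fixes m N :: nat
  assumes "m \<ge> 3" and "N = 16 * (m - 1) + 1"
  shows "8 * m - 7 \<le> \<Gamma> (grid_graph N m) \<and> \<Gamma> (grid_graph N m) \<le> 8 * m - 6"
proof
  obtain t where t: "m = t + 1" "t \<ge> 2" using assms(1) by (intro that[of "m - 1"]) auto
  let ?G = "grid_graph N m"
  interpret pair_graph ?G by (rule pair_graph_grid_graph)
  have fin: "finite {k. \<exists>c. complete_coloring ?G k c}"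
    by (rule finite_complete_coloring[OF pair_graph_grid_graph])
  have "\<exists>c. complete_coloring ?G (8 * m - 7) c"
    using complete_coloring_grid[OF t(2)] assms(2) t(1) by simp
  then show "8 * m - 7 \<le> \<Gamma> ?G"
    unfolding complete_coloring_number_def by (intro Max_ge fin) simp
  have "k \<le> 8 * m - 6" if "complete_coloring ?G k c" for k c
  proof (rule ccontr)
    assume "\<not> k \<le> 8 * m - 6"
    \<comment> \<open>Such a \<open>k\<close> needs \<open>64 * t * t + 40 * t + 6\<close> arcs, but
      at most \<open>64 * t * t + 34 * t\<close> exist; the count would still permit
      \<open>k = 8 * t + 2\<close>.\<close>
    then have "8 * t + 3 \<le> k" using t(1) by simp
    then have "(8 * t + 3) * (8 * t + 2) \<le> k * (k - 1)" by (intro mult_mono) auto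
    also have "\<dots> \<le> card (parcs ?G)"
      by (rule complete_coloring_le_arcs[OF pair_finite_arcs that])
    also have "\<dots> \<le> 2 * ((N - 1) * m + N * (m - 1))" by (rule card_parcs_grid_graph)
    also have "\<dots> = 2 * (16 * t * (t + 1) + (16 * t + 1) * t)"
      using assms(2) t(1) by simp
    finally show False by (simp add: algebra_simps)
  qed
  then show "\<Gamma> ?G \<le> 8 * m - 6"
    unfolding complete_coloring_number_def using fin ex_complete_coloring by (subst Max_le_iff) auto
qed

end
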